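(* Let $n\ge2$, let $A$ be a nonempty finite subset of $\mathbb{R}^n$, let $F\in\mathcal{F}^1(A)$ and assume $\kappa:=\Gamma^1(F;A)>0$. Then there exist infinitely many absolutely minimal Lipschitz extensions of $F$ on $\mathbb{R}^n$.
   Context: $\mathbb{R}^n$ carries the standard scalar product and Euclidean norm. A 1-field on a nonempty set $\Omega\subset\mathbb{R}^n$ is a map $F$ assigning to each $x\in \Omega$ the polynomial $F(x)(a)=f_x+\langle D_xf,a-x\rangle$ ($a\in\mathbb{R}^n$), where $f_x\in\mathbb{R}$ and $D_xf\in\mathbb{R}^n$. For $x\ne y$ in $\Omega$, $\Gamma^1(F;x,y)=2\sup_{a\in\mathbb{R}^n}\frac{|F(x)(a)-F(y)(a)|}{\|x-a\|^2+\|y-a\|^2}$, and for $S\subset\Omega$, $\Gamma^1(F;S)=\sup_{x\ne y\in S}\Gamma^1(F;x,y)$. $\mathcal{F}^1(\Omega)$ is the set of 1-fields on $\Omega$ with $\Gamma^1(F;\Omega)<+\infty$. For $\Omega_1\subset\Omega_2$ and $F\in\mathcal{F}^1(\Omega_1)$, $G\in\mathcal{F}^1(\Omega_2)$ is a minimal Lipschitz extension (MLE) of $F$ on $\Omega_2$ if $G(x)=F(x)$ for $x\in\Omega_1$ and $\Gamma^1(G;\Omega_2)=\Gamma^1(F;\Omega_1)$. $G$ is an absolutely minimal Lipschitz extension of $F$ on $\Omega_2$ if it is an MLE of $F$ on $\Omega_2$ and $\Gamma^1(G;V)=\Gamma^1(G;\partial V)$ for every nonempty bounded open $V$ with $\overline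 V\subset\Omega_2\setminus\Omega_1$. *)

theory Defs
  imports "HOL-Analysis.Analysis"
begin

(* A 1-field sends x to the polynomial F x, kept as a genuine function of a.
   Only the values F x with x in the domain are constrained. *)
definition one_field_on :: "(real^'n) set \<Rightarrow> (real^'n \<Rightarrow> real^'n \<Rightarrow> real) \<Rightarrow> bool" where
  "one_field_on \<Omega> F \<longleftrightarrow> (\<forall>x\<in>\<Omega>. \<exists>(c::real) (D::real^'n). \<forall>a. F x a = c + D \<bullet> (a - x))"

(* Suprema are taken in [0,\<infinity>], so no boundedness side condition is needed
   and the supremum over a set with fewer than two points is 0. *)
definition Gamma1_pair :: "(real^'n \<Rightarrow> real^'n \<Rightarrow> real) \<Rightarrow> real^'n \<Rightarrow> real^'n \<Rightarrow> ennreal" where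
  "Gamma1_pair F x y =
     2 * (SUP a. ennreal (\<bar>F x a - F y a\<bar> / ((norm (x - a))\<^sup>2 + (norm (y - a))\<^sup>2)))"

definition Gamma1 :: "(real^'n \<Rightarrow> real^'n \<Rightarrow> real) \<Rightarrow> (real^'n) set \<Rightarrow> ennreal" where
  "Gamma1 F S = (SUP (x, y) \<in> {(x, y). x \<in> S \<and> y \<in> S \<and> x \<noteq> y}. Gamma1_pair F x y)"

definition F1 :: "(real^'n) set \<Rightarrow> (real^'n \<Rightarrow> real^'n \<Rightarrow> real) set" where
  "F1 \<Omega> = {F. one_field_on \<Omega> F \<and> Gamma1 F \<Omega> < \<infinity>}"

definition MLE ::
  "(real^'n) set \<Rightarrow> (real^'n \<Rightarrow> real^'n \<Rightarrow> real) \<Rightarrow> (real^'n) set \<Rightarrow>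
   (real^'n \<Rightarrow> real^'n \<Rightarrow> real) \<Rightarrow> bool" where
  "MLE \<Omega>1 F \<Omega>2 G \<longleftrightarrow>
     G \<in> F1 \<Omega>2 \<and> (\<forall>x\<in>\<Omega>1. G x = F x) \<and> Gamma1 G \<Omega>2 = Gamma1 F \<Omega>1"

definition AMLE ::
  "(real^'n) set \<Rightarrow> (real^'n \<Rightarrow> real^'n \<Rightarrow> real) \<Rightarrow> (real^'n) set \<Rightarrow>
   (real^'n \<Rightarrow> real^'n \<Rightarrow> real) \<Rightarrow> bool" where
  "AMLE \<Omega>1 F \<Omega>2 G \<longleftrightarrow>
     MLE \<Omega>1 F \<Omega>2 G \<and>
     (\<forall>V. V \<noteq> {} \<and> bounded V \<and> open V \<and> closure V \<subseteq> \<Omega>2 - \<Omega>1 \<longrightarrow>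
        Gamma1 G V = Gamma1 G (frontier V))"

end

theory Submission
  imports Defs
begin

text \<open>
  Let \<open>\<kappa> = \<Gamma>\<^sup>1(F; A)\<close>.  An affine function attached to a base point \<open>x\<close>, with value
  \<open>f\<close> and gradient \<open>D\<close> there, is encoded by a triple \<open>(z, v, g)\<close> with \<open>x = z + v\<close> and
  \<open>D = \<kappa> (v - z)\<close>; the number \<open>g\<close> carries the value.  In these coordinates the
  condition \<open>\<Gamma>\<^sup>1(F; x, x') \<le> \<kappa>\<close> becomes the pair of inequalities
  \<open>g' \<ge> g + v \<bullet> (z' - z)\<close> and \<open>g \<ge> g' + v' \<bullet> (z - z')\<close> (\<open>Gamma1_pair_jets_le_iff\<close>): the
  triples are points of the graph of a convex function \<open>z \<mapsto> g\<close> together with subgradients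
  \<open>v\<close>.  Equality in one of the two inequalities forces \<open>\<Gamma>\<^sup>1(F; x, x') \<ge> \<kappa>\<close>.

  So extensions with constant at most \<open>\<kappa>\<close> arise from closed convex functions that have the
  prescribed values and subgradients.  The convex functions used here are the lower convex
  envelopes of finitely many points \<open>(z\<^sub>i, c\<^sub>i)\<close>.  It is convenient to work with the conjugate
  \<open>h(v) = max\<^sub>i (z\<^sub>i \<bullet> v - c\<^sub>i)\<close>: a triple is then a pair \<open>(z, v)\<close> with \<open>z \<in> \<partial>h(v)\<close>, the
  decomposition \<open>x = z + v\<close> exists uniquely for every \<open>x\<close> because \<open>v\<close> is the proximal
  point of \<open>x\<close> with respect to \<open>h\<close>, and \<open>g = z \<bullet> v - h(v)\<close>.

  Absolute minimality (\<open>Gamma1_envelope_field_eq\<close>) asks for two points of \<open>\<partial>V\<close> at which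
  \<open>\<Gamma>\<^sup>1\<close> is at least \<open>\<kappa>\<close>, and any two distinct points \<open>z + v\<close>, \<open>z' + v'\<close> with \<open>v = v'\<close> or with
  \<open>z = z' = z\<^sub>i\<close> will do.  Take \<open>x = z + v\<close> in \<open>V\<close>.  The points with the same \<open>v\<close>
  form a polytope with the vertices among the \<open>z\<^sub>i + v\<close>.  Either \<open>\<partial>V\<close> meets it twice, or
  \<open>V\<close> contains a \<open>z\<^sub>i + v\<close> that lies in the cell \<open>{z\<^sub>i + w | i active at w}\<close>.  Once redundant
  indices are dropped, every cell is convex with nonempty interior, so in dimension at least two
  \<open>\<partial>V\<close> meets it twice as soon as the cell has a point outside the closure of \<open>V\<close>.
  The cell of a data point contains that point of \<open>A\<close>, which is not in the closure of \<open>V\<close>.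

  Infinitely many solutions come from adding to the data one more point \<open>(b, c)\<close> where \<open>b\<close> lies
  outside the convex hull of the other \<open>z\<^sub>i\<close> and \<open>c\<close> is an arbitrary large number.  As \<open>c\<close> is
  large, the subgradient conditions at the data survive; as \<open>b\<close> is outside the hull, its cell is
  unbounded and hence leaves every bounded \<open>V\<close>; and on that cell the field determines \<open>c\<close>.
\<close>

section \<open>Maxima of finitely many affine functions\<close>

text \<open>A pair \<open>(z, c)\<close> stands for the affine function \<open>v \<mapsto> z \<bullet> v - c\<close>; the maximum is the
  convex conjugate of the lower convex envelope of the points \<open>(z, c)\<close>.\<close>

definition max_affine :: "('a::euclidean_space \<times> real) set \<Rightarrow> 'a \<Rightarrow> real" where
  "max_affine I v = Max ((\<lambda>i. fst i \<bullet> v - snd i) ` I)"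

definition subgrad :: "('a::euclidean_space \<times> real) set \<Rightarrow> 'a \<Rightarrow> 'a \<Rightarrow> bool" where
  "subgrad I z v \<longleftrightarrow> (\<forall>v'. max_affine I v + z \<bullet> (v' - v) \<le> max_affine I v')"

definition active :: "('a::euclidean_space \<times> real) set \<Rightarrow> 'a \<Rightarrow> ('a \<times> real) set" where
  "active I v = {i \<in> I. fst i \<bullet> v - snd i = max_affine I v}"

lemma max_affine_ge:
  assumes "finite I" "i \<in> I"
  shows "fst i \<bullet> v - snd i \<le> max_affine I v"
  using assms unfolding max_affine_def by auto

lemma max_affine_attained:
  assumes "finite I" "I \<noteq> {}"
  obtains i where "i \<in> active I v"
proof -
  have "max_affine I v \<in> (\<lambda>i. fst i \<bullet> v - snd i) ` I"
    unfolding max_affine_def using assms by (intro Max_in) auto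
  then show ?thesis using that unfolding active_def by auto
qed

lemma active_iff:
  assumes "finite I" "i \<in> I"
  shows "i \<in> active I v \<longleftrightarrow> (\<forall>j\<in>I. fst j \<bullet> v - snd j \<le> fst i \<bullet> v - snd i)"
proof
  assume "i \<in> active I v"
  then show "\<forall>j\<in>I. fst j \<bullet> v - snd j \<le> fst i \<bullet> v - snd i"
    using max_affine_ge[OF assms(1)] unfolding active_def by auto
next
  assume *: "\<forall>j\<in>I. fst j \<bullet> v - snd j \<le> fst i \<bullet> v - snd i"
  have "max_affine I v = fst i \<bullet> v - snd i"
    unfolding max_affine_def by (rule Max_eqI) (use assms * in auto)
  then show "i \<in> active I v" using assms unfolding active_def by simp
qed

lemma max_affine_convex:
  assumes "finite I" "I \<noteq> {}" "0 \<le> t" "t \<le> 1"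
  shows "max_affine I ((1 - t) *\<^sub>R v + t *\<^sub>R w)
    \<le> (1 - t) * max_affine I v + t * max_affine I w"
proof -
  obtain i where i: "i \<in> active I ((1 - t) *\<^sub>R v + t *\<^sub>R w)"
    using max_affine_attained assms by blast
  then have "max_affine I ((1 - t) *\<^sub>R v + t *\<^sub>R w)
      = (1 - t) * (fst i \<bullet> v - snd i) + t * (fst i \<bullet> w - snd i)"
    unfolding active_def by (auto simp: inner_add_right algebra_simps)
  also have "\<dots> \<le> (1 - t) * max_affine I v + t * max_affine I w"
    using i assms max_affine_ge[OF assms(1)] unfolding active_def
    by (intro add_mono mult_left_mono) auto
  finally show ?thesis .
qed

lemma continuous_on_max_affine:
  assumes "finite I" "I \<noteq> {}"
  shows "continuous_on UNIV (max_affine I)"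
  using assms
proof (induction I rule: finite_ne_induct)
  case (singleton i)
  then show ?case unfolding max_affine_def by (auto intro!: continuous_intros)
next
  case (insert i I)
  have "max_affine (insert i I) = (\<lambda>v. max (fst i \<bullet> v - snd i) (max_affine I v))"
    unfolding max_affine_def using insert by (auto simp: fun_eq_iff)
  then show ?case using insert by (auto intro!: continuous_intros)
qed

lemma subgrad_of_active:
  assumes "finite I" "i \<in> active I v"
  shows "subgrad I (fst i) v"
  unfolding subgrad_def
proof
  fix v'
  have "max_affine I v + fst i \<bullet> (v' - v) = fst i \<bullet> v' - snd i"
    using assms unfolding active_def by (auto simp: inner_diff_right)
  also have "\<dots> \<le> max_affine I v'" using assms max_affine_ge[of I i v'] unfolding active_def by simp
  finally show "max_affine I v + fst i \<bullet> (v' - v) \<le> max_affine I v'" .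
qed

lemma subgrad_convex: "convex {z. subgrad I z v}"
proof -
  have "{z. subgrad I z v} = (\<Inter>v'. {z. (v' - v) \<bullet> z \<le> max_affine I v' - max_affine I v})"
    unfolding subgrad_def by (auto simp: inner_commute algebra_simps)
  then show ?thesis by (auto intro!: convex_INT convex_halfspace_le)
qed

text \<open>A subgradient outside the convex hull of the active slopes could be separated from them by a
  direction \<open>u\<close>.  Moving from \<open>v\<close> a little along \<open>u\<close>, the active functions would then grow too
  slowly for the subgradient inequality, and the inactive ones, being strictly smaller at \<open>v\<close>,
  cannot catch up.\<close>

lemma subgrad_iff_hull:
  assumes "finite I" "I \<noteq> {}"
  shows "subgrad I z v \<longleftrightarrow> z \<in> convex hull (fst ` active I v)"
proof
  assume "z \<in> convex hull (fst ` active I v)"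
  moreover have "convex hull (fst ` active I v) \<subseteq> {z. subgrad I z v}"
    using subgrad_of_active[OF assms(1)] subgrad_convex by (intro hull_minimal) auto
  ultimately show "subgrad I z v" by auto
next
  assume sub: "subgrad I z v"
  show "z \<in> convex hull (fst ` active I v)"
  proof (rule ccontr)
    assume z: "z \<notin> convex hull (fst ` active I v)"
    have "closed (convex hull (fst ` active I v))"
      using assms unfolding active_def
      by (intro compact_imp_closed compact_convex_hull finite_imp_compact) auto
    from separating_hyperplane_closed_point[OF convex_convex_hull this z]
    obtain a b where a: "a \<bullet> z < b" "\<And>y. y \<in> convex hull (fst ` active I v) \<Longrightarrow> a \<bullet> y > b"
      by blast
    define u where "u = - a"
    have u: "fst i \<bullet> u < z \<bullet> u" if "i \<in> active I v" for i
      using a(1) a(2)[OF hull_inc, of "fst i"] that unfolding u_def by (auto simp: inner_commute)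
    have "\<forall>\<^sub>F t in at_right 0. fst i \<bullet> (v + t *\<^sub>R u) - snd i < max_affine I v + t * (z \<bullet> u)"
      if i: "i \<in> I" for i
    proof (cases "i \<in> active I v")
      case True
      have "\<forall>\<^sub>F t in at_right 0. (0::real) < t" by (simp add: eventually_at_right_less)
      then show ?thesis
      proof eventually_elim
        case (elim t)
        then have "t * (fst i \<bullet> u) < t * (z \<bullet> u)" using u[OF True] by simp
        then show ?case using True by (simp add: active_def inner_add_right)
      qed
    next
      case False
      then have less: "fst i \<bullet> (v + 0 *\<^sub>R u) - snd i - (max_affine I v + 0 * (z \<bullet> u)) < 0"
        using max_affine_ge[OF assms(1) i, of v] i unfolding active_def by auto
      have "((\<lambda>t. fst i \<bullet> (v + t *\<^sub>R u) - snd i - (max_affine I v + t * (z \<bullet> u))) \<longlongrightarrow>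
          fst i \<bullet> (v + 0 *\<^sub>R u) - snd i - (max_affine I v + 0 * (z \<bullet> u))) (at_right 0)"
        by (intro tendsto_intros)
      from order_tendstoD(2)[OF this less] show ?thesis by simp
    qed
    then have "\<forall>\<^sub>F t in at_right 0. \<forall>i\<in>I.
        fst i \<bullet> (v + t *\<^sub>R u) - snd i < max_affine I v + t * (z \<bullet> u)"
      by (intro eventually_ball_finite assms) auto
    then obtain t where t: "\<And>i. i \<in> I \<Longrightarrow>
        fst i \<bullet> (v + t *\<^sub>R u) - snd i < max_affine I v + t * (z \<bullet> u)"
      by (metis (no_types, lifting) eventually_happens trivial_limit_at_right_real)
    obtain i where "i \<in> active I (v + t *\<^sub>R u)" using max_affine_attained assms by blast
    then have "max_affine I (v + t *\<^sub>R u) < max_affine I v + t * (z \<bullet> u)"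
      using t[of i] by (simp add: active_def)
    then show False using sub unfolding subgrad_def
      by (metis add_diff_cancel_left' inner_scaleR_right not_le)
  qed
qed

text \<open>Subgradients are monotone, \<open>(z - z') \<bullet> (v - v') \<ge> 0\<close>, while \<open>z - z' = - (v - v')\<close> when the sums
  agree.\<close>

lemma subgrad_decomposition_unique:
  assumes "subgrad I z v" "subgrad I z' v'" "z + v = z' + v'"
  shows "v = v'"
proof -
  have "z \<bullet> (v' - v) + z' \<bullet> (v - v') \<le> 0"
    using assms(1,2) unfolding subgrad_def by (smt (verit))
  moreover have "z = z' + v' - v" using assms(3) by (simp add: algebra_simps)
  ultimately have "(v' - v) \<bullet> (v' - v) \<le> 0"
    by (simp add: inner_diff_left inner_diff_right inner_add_left inner_commute algebra_simps)
  then show ?thesis by (metis eq_iff_diff_eq_0 inner_gt_zero_iff not_le)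
qed

text \<open>The decomposition is given by the minimiser \<open>v\<close> of \<open>max_affine I v + |v - x|\<^sup>2 / 2\<close>, the
  proximal point of \<open>x\<close>: the optimality condition at \<open>v\<close> is that \<open>x - v\<close> is a subgradient.\<close>

lemma subgrad_decomposition_exists:
  assumes fin: "finite I" "I \<noteq> {}"
  shows "\<exists>v. subgrad I (x - v) v"
proof -
  define \<Phi> where "\<Phi> v = max_affine I v + (norm (v - x))\<^sup>2 / 2" for v
  obtain i where i: "i \<in> I" using fin by blast
  define m where "m = x - fst i"
  \<comment> \<open>One affine function alone already makes the objective coercive: \<open>m\<close> is the minimum point of
    the resulting quadratic lower bound, and outside the ball of radius \<open>r\<close> about \<open>m\<close> that bound
    exceeds the value at \<open>x\<close>.\<close>
  define r where "r = norm (x - m) + sqrt (2 * \<bar>\<Phi> x - (fst i \<bullet> x - snd i - (norm (fst i))\<^sup>2 / 2)\<bar>)"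
  have low: "\<Phi> v \<ge> fst i \<bullet> x - snd i - (norm (fst i))\<^sup>2 / 2 + (norm (v - m))\<^sup>2 / 2" for v
    using max_affine_ge[OF fin(1) i, of v] unfolding \<Phi>_def m_def power2_norm_eq_inner
    by (simp add: inner_diff_left inner_diff_right inner_add_left inner_add_right inner_commute
        algebra_simps add_divide_distrib diff_divide_distrib)
  have cont: "continuous_on (cball m r) \<Phi>"
    unfolding \<Phi>_def
    by (intro continuous_intros continuous_on_subset[OF continuous_on_max_affine[OF fin]]) auto
  have xin: "x \<in> cball m r" unfolding r_def by (auto simp: dist_norm norm_minus_commute)
  then obtain v where v: "v \<in> cball m r" "\<And>w. w \<in> cball m r \<Longrightarrow> \<Phi> v \<le> \<Phi> w"
    using continuous_attains_inf[OF compact_cball _ cont] by blast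
  have min: "\<Phi> v \<le> \<Phi> w" for w
  proof (cases "w \<in> cball m r")
    case False
    let ?d = "\<Phi> x - (fst i \<bullet> x - snd i - (norm (fst i))\<^sup>2 / 2)"
    have "r < norm (w - m)" using False by (simp add: dist_norm norm_minus_commute)
    then have "sqrt (2 * \<bar>?d\<bar>) \<le> norm (w - m)"
      using norm_ge_zero[of "x - m"] unfolding r_def by linarith
    then have "2 * \<bar>?d\<bar> \<le> (norm (w - m))\<^sup>2" by (rule sqrt_le_D)
    moreover have "d \<le> N / 2" if "2 * \<bar>d\<bar> \<le> N" for d N :: real using that by arith
    ultimately have "?d \<le> (norm (w - m))\<^sup>2 / 2" by blast
    then have "\<Phi> x \<le> \<Phi> w" using low[of w] by (simp add: algebra_simps)
    then show ?thesis using v(2)[OF xin] by simp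
  qed (use v in auto)
  have "max_affine I v + (x - v) \<bullet> (v' - v) \<le> max_affine I v'" for v'
  proof -
    define d where "d = v' - v"
    \<comment> \<open>Comparing \<open>v\<close> with \<open>v + t d\<close> yields the subgradient inequality up to a term of order
      \<open>t\<close>, which disappears as \<open>t\<close> tends to 0.\<close>
    have *: "max_affine I v' - max_affine I v - (x - v) \<bullet> d + t * ((norm d)\<^sup>2 / 2) \<ge> 0"
      if t: "0 < t" "t < 1" for t
    proof -
      have eq: "v + t *\<^sub>R d = (1 - t) *\<^sub>R v + t *\<^sub>R v'" unfolding d_def by (simp add: algebra_simps)
      have "\<Phi> v \<le> (1 - t) * max_affine I v + t * max_affine I v' + (norm (v + t *\<^sub>R d - x))\<^sup>2 / 2"
        using min[of "v + t *\<^sub>R d"] max_affine_convex[OF fin, of t v v'] t eq unfolding \<Phi>_def by simp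
      moreover have "(norm (v + t *\<^sub>R d - x))\<^sup>2 = (norm (v - x))\<^sup>2 - 2 * t * ((x - v) \<bullet> d) + t\<^sup>2 * (norm d)\<^sup>2"
        unfolding power2_norm_eq_inner
        by (simp add: inner_diff_left inner_diff_right inner_add_left inner_add_right inner_commute
            algebra_simps power2_eq_square)
      ultimately have "0 \<le> t * (max_affine I v' - max_affine I v - (x - v) \<bullet> d + t * ((norm d)\<^sup>2 / 2))"
        unfolding \<Phi>_def by (simp add: field_simps power2_eq_square)
      then show ?thesis using t by (simp add: zero_le_mult_iff)
    qed
    have "((\<lambda>t. max_affine I v' - max_affine I v - (x - v) \<bullet> d + t * ((norm d)\<^sup>2 / 2)) \<longlongrightarrow>
       max_affine I v' - max_affine I v - (x - v) \<bullet> d + 0 * ((norm d)\<^sup>2 / 2)) (at_right 0)"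
      by (intro tendsto_intros)
    moreover have "\<forall>\<^sub>F t in at_right (0::real). 0 \<le> max_affine I v' - max_affine I v - (x - v) \<bullet> d + t * ((norm d)\<^sup>2 / 2)"
      using eventually_at_right_real[of 0 1] by (rule eventually_mono) (use * in auto)
    ultimately have "0 \<le> max_affine I v' - max_affine I v - (x - v) \<bullet> d + 0 * ((norm d)\<^sup>2 / 2)"
      by (rule tendsto_lowerbound) simp
    then show ?thesis unfolding d_def by simp
  qed
  then show ?thesis unfolding subgrad_def by blast
qed

section \<open>Convex sets that cross a frontier twice\<close>

text \<open>Every segment from \<open>x\<close> to a point outside the closure of \<open>V\<close> crosses the frontier of \<open>V\<close>.
  Since \<open>T\<close> is not contained in a line, \<open>y\<close> can be pushed inside \<open>T\<close> off the line
  through \<open>x\<close> and \<open>y\<close> without entering the closure.  The two segments from \<open>x\<close> obtained in this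
  way have only \<open>x\<close> in common, and \<open>x\<close> is not on the frontier, so the two crossings differ.\<close>

lemma two_frontier_points_in_convex:
  fixes T V :: "'a::euclidean_space set"
  assumes "convex T" "interior T \<noteq> {}" "DIM('a) \<ge> 2"
    and "open V" "x \<in> T" "x \<in> V" "y \<in> T" "y \<notin> closure V"
  obtains p q where "p \<in> T" "q \<in> T" "p \<in> frontier V" "q \<in> frontier V" "p \<noteq> q"
proof -
  have hit: "\<exists>t>0. x + t *\<^sub>R (w - x) \<in> frontier V \<inter> T" if "w \<in> T" "w \<notin> closure V" for w
  proof -
    have "closed_segment x w \<inter> frontier V \<noteq> {}"
      using that assms closure_subset by (intro connected_Int_frontier) auto
    then obtain q where q: "q \<in> closed_segment x w" "q \<in> frontier V" by blast
    then obtain t where t: "0 \<le> t" "q = x + t *\<^sub>R (w - x)"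
      unfolding in_segment by (auto simp: algebra_simps)
    have "q \<noteq> x" using q assms by (auto simp: frontier_def interior_open)
    moreover have "q \<in> T" using q assms that closed_segment_subset by blast
    ultimately show ?thesis using q t by (intro exI[of _ t]) (auto simp: less_le)
  qed
  have "\<not> T \<subseteq> affine hull {x, y}"
  proof
    assume "T \<subseteq> affine hull {x, y}"
    then have "aff_dim T \<le> aff_dim {x, y}" by (metis aff_dim_affine_hull aff_dim_subset)
    moreover have "aff_dim T = DIM('a)" using assms by (simp add: aff_dim_nonempty_interior)
    moreover have "aff_dim {x, y} \<le> 1" by (simp add: aff_dim_2)
    ultimately show False using assms by simp
  qed
  then obtain e where e: "e \<in> T" "e \<notin> affine hull {x, y}" by blast
  have lim: "((\<lambda>t. y + t *\<^sub>R (e - y)) \<longlongrightarrow> y + 0 *\<^sub>R (e - y)) (at_right 0)"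
    by (intro tendsto_intros)
  have "\<forall>\<^sub>F t in at_right 0. y + t *\<^sub>R (e - y) \<in> - closure V"
    by (rule topological_tendstoD[OF lim]) (use assms in auto)
  moreover have "\<forall>\<^sub>F t in at_right 0. (0::real) < t \<and> t < 1"
    using eventually_at_right_real[of 0 1] by (auto elim: eventually_mono)
  ultimately have "\<forall>\<^sub>F t in at_right 0. y + t *\<^sub>R (e - y) \<in> - closure V \<and> 0 < t \<and> t < 1"
    by eventually_elim auto
  then obtain t where t: "y + t *\<^sub>R (e - y) \<notin> closure V" "0 < t" "t < 1"
    by (metis (no_types, lifting) ComplD eventually_happens trivial_limit_at_right_real)
  define y' where "y' = y + t *\<^sub>R (e - y)"
  have "y' = (1 - t) *\<^sub>R y + t *\<^sub>R e" unfolding y'_def by (simp add: algebra_simps)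
  then have y': "y' \<in> T" using t assms e by (simp add: convex_alt)
  obtain s where s: "s > 0" "x + s *\<^sub>R (y - x) \<in> frontier V \<inter> T" using hit assms by blast
  obtain s' where s': "s' > 0" "x + s' *\<^sub>R (y' - x) \<in> frontier V \<inter> T"
    using hit[OF y'] t y'_def by blast
  have "x + s *\<^sub>R (y - x) \<noteq> x + s' *\<^sub>R (y' - x)"
  proof
    assume "x + s *\<^sub>R (y - x) = x + s' *\<^sub>R (y' - x)"
    \<comment> \<open>Solving for \<open>e\<close> writes it as an affine combination of \<open>x\<close> and \<open>y\<close>.\<close>
    then have "(s' * t) *\<^sub>R e = s *\<^sub>R (y - x) + s' *\<^sub>R x - (s' * (1 - t)) *\<^sub>R y"
      unfolding y'_def by (simp add: algebra_simps)
    also have "\<dots> = (s' - s) *\<^sub>R x + (s - s' * (1 - t)) *\<^sub>R y" by (simp add: algebra_simps)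
    finally have "e = (1 / (s' * t)) *\<^sub>R ((s' - s) *\<^sub>R x + (s - s' * (1 - t)) *\<^sub>R y)"
      using s' t by (simp add: vector_fraction_eq_iff eq_vector_fraction_iff)
    then have "e = ((s' - s) / (s' * t)) *\<^sub>R x + ((s - s' * (1 - t)) / (s' * t)) *\<^sub>R y"
      by (simp add: scaleR_add_right)
    moreover have "(s' - s) / (s' * t) + (s - s' * (1 - t)) / (s' * t) = 1"
      using s' t by (simp add: field_simps)
    ultimately show False using e unfolding affine_hull_2 by blast
  qed
  then show ?thesis using that s s' by blast
qed

text \<open>If the frontier met the hull in one point \<open>q\<close> only, the segments from \<open>x\<close> to all points of \<open>P\<close>
  would pass through \<open>q\<close>.  Then \<open>P\<close> would lie strictly on one side of the hyperplane through \<open>x\<close>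
  orthogonal to \<open>q - x\<close>, and \<open>x\<close> could not be in its convex hull.\<close>

lemma vertex_or_two_frontier_points_in_hull:
  fixes V P :: "'a::euclidean_space set"
  assumes "open V" "x \<in> V" "x \<in> convex hull P" "P \<inter> V = {}"
  obtains p q where "p \<in> convex hull P" "q \<in> convex hull P"
    "p \<in> frontier V" "q \<in> frontier V" "p \<noteq> q"
proof -
  have hit: "\<exists>q. q \<in> convex hull P \<and> q \<in> frontier V \<and> (p - x) \<bullet> (q - x) > 0" if p: "p \<in> P" for p
  proof -
    have "closed_segment x p \<inter> frontier V \<noteq> {}"
      using p assms by (intro connected_Int_frontier) auto
    then obtain q where q: "q \<in> closed_segment x p" "q \<in> frontier V" by blast
    then obtain t where t: "0 \<le> t" "q = x + t *\<^sub>R (p - x)"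
      unfolding in_segment by (auto simp: algebra_simps)
    have "q \<noteq> x" using q assms by (auto simp: frontier_def interior_open)
    then have "t > 0" "p - x \<noteq> 0" using t by (auto simp: less_le)
    then have "t * ((p - x) \<bullet> (p - x)) > 0" by (metis inner_gt_zero_iff mult_pos_pos)
    moreover have "q \<in> convex hull P"
      using closed_segment_subset[OF assms(3) hull_inc[OF p] convex_convex_hull] q(1) by (rule subsetD)
    moreover have "(p - x) \<bullet> (q - x) = t * ((p - x) \<bullet> (p - x))" using t by simp
    ultimately show ?thesis using q(2) by metis
  qed
  have "P \<noteq> {}" using assms by auto
  then obtain p0 where "p0 \<in> P" by blast
  then obtain q where q: "q \<in> convex hull P" "q \<in> frontier V" using hit by blast
  show ?thesis
  proof (cases "\<forall>p\<in>P. (q - x) \<bullet> (p - x) > 0")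
    case True
    then have "P \<subseteq> {y. (q - x) \<bullet> y > (q - x) \<bullet> x}" by (auto simp: inner_diff_right)
    then have "convex hull P \<subseteq> {y. (q - x) \<bullet> y > (q - x) \<bullet> x}"
      by (intro hull_minimal convex_halfspace_gt)
    then show ?thesis using assms by auto
  next
    case False
    then obtain p where p: "p \<in> P" "\<not> (q - x) \<bullet> (p - x) > 0" by blast
    from hit[OF p(1)] obtain q' where q': "q' \<in> convex hull P" "q' \<in> frontier V"
      "(p - x) \<bullet> (q' - x) > 0" by blast
    then have "q \<noteq> q'" using p by (auto simp: inner_commute)
    then show ?thesis using that q q' by blast
  qed
qed

section \<open>Affine functions in the coordinates adapted to \<open>\<Gamma>\<^sup>1\<close>\<close>

text \<open>The two quadratic terms in \<open>a\<close> cancel: this is the affine function of \<open>a\<close> with gradient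
  \<open>k (v - z)\<close>, to be thought of as attached to the base point \<open>z + v\<close>.  The constant is
  normalised so that the extremal comparison of two such functions involves only
  \<open>g' - g - v \<bullet> (z' - z)\<close>, see \<open>jet_difference\<close>.\<close>

definition jet :: "real \<Rightarrow> 'a::euclidean_space \<Rightarrow> 'a \<Rightarrow> real \<Rightarrow> 'a \<Rightarrow> real" where
  "jet k z v g a = k * (2 * g - z \<bullet> v + ((norm (a - z))\<^sup>2 - (norm (a - v))\<^sup>2) / 2)"

text \<open>Completing the square: the left-hand side, whose sign decides whether \<open>a\<close> violates the bound
  \<open>k > 0\<close> on \<open>\<Gamma>\<^sup>1\<close>, is smallest at \<open>a = v + z'\<close>, and there it is a multiple of the defect in the
  subgradient inequality.\<close>

lemma jet_difference:
  "k * ((norm (z + v - a))\<^sup>2 + (norm (z' + v' - a))\<^sup>2) - 2 * (jet k z v g a - jet k z' v' g' a)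
    = 4 * k * (g' - (g + v \<bullet> (z' - z))) + 2 * k * (norm (a - (v + z')))\<^sup>2"
  unfolding jet_def power2_norm_eq_inner
  by (simp add: inner_diff_left inner_diff_right inner_add_left inner_add_right inner_commute
      algebra_simps add_divide_distrib diff_divide_distrib)

lemma jet_affine:
  "jet k z v g a = jet k z v g (z + v) + (k *\<^sub>R (v - z)) \<bullet> (a - (z + v))"
  unfolding jet_def power2_norm_eq_inner
  by (simp add: inner_diff_left inner_diff_right inner_add_left inner_add_right inner_commute
      algebra_simps add_divide_distrib diff_divide_distrib)

lemma affine_as_jet:
  assumes "k \<noteq> 0"
  obtains z v g where "x = z + v" "\<And>a. c + D \<bullet> (a - x) = jet k z v g a"
proof -
  \<comment> \<open>The unique solution of \<open>x = z + v\<close> and \<open>D = k (v - z)\<close>; then \<open>g\<close> adjusts the value at \<open>x\<close>.\<close>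
  define z where "z = (1/2) *\<^sub>R (x - (1/k) *\<^sub>R D)"
  define v where "v = (1/2) *\<^sub>R (x + (1/k) *\<^sub>R D)"
  define g where "g = (c - jet k z v 0 x) / (2 * k)"
  have x: "x = z + v" unfolding z_def v_def by (simp add: algebra_simps flip: scaleR_add_left)
  have D: "k *\<^sub>R (v - z) = D" unfolding z_def v_def using assms
    by (simp add: algebra_simps flip: scaleR_add_left)
  have "jet k z v g x = c" unfolding g_def jet_def using assms by (simp add: field_simps)
  then have "c + D \<bullet> (a - x) = jet k z v g a" for a
    using jet_affine[of k z v g a] x D by simp
  then show ?thesis using that x by blast
qed

lemma Gamma1_pair_le_iff:
  fixes F :: "real^'n \<Rightarrow> real^'n \<Rightarrow> real"
  assumes "x \<noteq> y" "k \<ge> 0"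
  shows "Gamma1_pair F x y \<le> ennreal k \<longleftrightarrow>
    (\<forall>a. 2 * \<bar>F x a - F y a\<bar> \<le> k * ((norm (x - a))\<^sup>2 + (norm (y - a))\<^sup>2))"
proof -
  have "2 * ennreal r = ennreal (2 * r)" if "r \<ge> 0" for r
    using that by (simp add: ennreal_mult)
  moreover have pos: "(norm (x - a))\<^sup>2 + (norm (y - a))\<^sup>2 > 0" for a
    using assms by (metis eq_iff_diff_eq_0 norm_eq_zero sum_power2_gt_zero_iff)
  ultimately show ?thesis
    unfolding Gamma1_pair_def SUP_mult_left_ennreal SUP_le_iff
    using assms by (simp add: divide_le_eq less_imp_le)
qed

text \<open>By \<open>jet_difference\<close> the bound need only be tested at the two worst points, \<open>a = v + z'\<close> for one
  sign of the difference and \<open>a = v' + z\<close> for the other.\<close>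

lemma Gamma1_pair_jets_le_iff:
  fixes G :: "real^'n \<Rightarrow> real^'n \<Rightarrow> real"
  assumes k: "k > 0" and xy: "x \<noteq> y" "x = z + v" "y = z' + v'"
    and G: "G x = jet k z v g" "G y = jet k z' v' g'"
  shows "Gamma1_pair G x y \<le> ennreal k \<longleftrightarrow>
    g + v \<bullet> (z' - z) \<le> g' \<and> g' + v' \<bullet> (z - z') \<le> g"
proof -
  have d1: "k * ((norm (x - a))\<^sup>2 + (norm (y - a))\<^sup>2) - 2 * (G x a - G y a)
      = 4 * k * (g' - (g + v \<bullet> (z' - z))) + 2 * k * (norm (a - (v + z')))\<^sup>2" for a
    using jet_difference[of k z v a z' v' g g'] G xy by simp
  have d2: "k * ((norm (x - a))\<^sup>2 + (norm (y - a))\<^sup>2) - 2 * (G y a - G x a)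
      = 4 * k * (g - (g' + v' \<bullet> (z - z'))) + 2 * k * (norm (a - (v' + z)))\<^sup>2" for a
    using jet_difference[of k z' v' a z v g' g] G xy by (simp add: add.commute)
  have gap: "0 \<le> N - 2 * d" if "2 * \<bar>d\<bar> \<le> N" for d N :: real using that by arith
  have gaps: "2 * \<bar>d\<bar> \<le> N"
    if "N - 2 * d = P" "N - 2 * (- d) = Q" "0 \<le> P" "0 \<le> Q" for d N P Q :: real
    using that by arith
  have sq0: "(norm (b - b))\<^sup>2 = 0" for b :: "real^'n" by simp
  show ?thesis
    unfolding Gamma1_pair_le_iff[OF xy(1) less_imp_le[OF k]]
  proof safe
    assume *: "\<forall>a. 2 * \<bar>G x a - G y a\<bar> \<le> k * ((norm (x - a))\<^sup>2 + (norm (y - a))\<^sup>2)"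
    have "0 \<le> k * ((norm (x - (v + z')))\<^sup>2 + (norm (y - (v + z')))\<^sup>2)
        - 2 * (G x (v + z') - G y (v + z'))"
      using *[rule_format, of "v + z'"] by (intro gap)
    also have "\<dots> = 4 * k * (g' - (g + v \<bullet> (z' - z)))"
      using d1[of "v + z'"] by (simp only: sq0 mult_zero_right add_0_right)
    finally have "0 \<le> 4 * k * (g' - (g + v \<bullet> (z' - z)))" .
    then show "g + v \<bullet> (z' - z) \<le> g'" using k by (simp add: zero_le_mult_iff)
    have "0 \<le> k * ((norm (x - (v' + z)))\<^sup>2 + (norm (y - (v' + z)))\<^sup>2)
        - 2 * (G y (v' + z) - G x (v' + z))"
      using *[rule_format, of "v' + z"] by (intro gap) (simp add: abs_minus_commute)
    also have "\<dots> = 4 * k * (g - (g' + v' \<bullet> (z - z')))"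
      using d2[of "v' + z"] by (simp only: sq0 mult_zero_right add_0_right)
    finally have "0 \<le> 4 * k * (g - (g' + v' \<bullet> (z - z')))" .
    then show "g' + v' \<bullet> (z - z') \<le> g" using k by (simp add: zero_le_mult_iff)
  next
    fix a
    assume 1: "g + v \<bullet> (z' - z) \<le> g'" and 2: "g' + v' \<bullet> (z - z') \<le> g"
    have "0 \<le> 4 * k * (g' - (g + v \<bullet> (z' - z))) + 2 * k * (norm (a - (v + z')))\<^sup>2"
      using 1 k by simp
    moreover have "0 \<le> 4 * k * (g - (g' + v' \<bullet> (z - z'))) + 2 * k * (norm (a - (v' + z)))\<^sup>2"
      using 2 k by simp
    moreover have d2': "k * ((norm (x - a))\<^sup>2 + (norm (y - a))\<^sup>2) - 2 * - (G x a - G y a)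
        = 4 * k * (g - (g' + v' \<bullet> (z - z'))) + 2 * k * (norm (a - (v' + z)))\<^sup>2"
      using d2[of a] by (simp only: minus_diff_eq)
    ultimately show "2 * \<bar>G x a - G y a\<bar> \<le> k * ((norm (x - a))\<^sup>2 + (norm (y - a))\<^sup>2)"
      by (intro gaps[OF d1[of a] d2'])
  qed
qed

text \<open>When the subgradient inequality is an equality, the quotient in the definition of \<open>\<Gamma>\<^sup>1\<close>
  takes the value \<open>k / 2\<close> at \<open>a = v + z'\<close>, because the square in \<open>jet_difference\<close> vanishes too.\<close>

lemma Gamma1_pair_jets_ge:
  fixes G :: "real^'n \<Rightarrow> real^'n \<Rightarrow> real"
  assumes k: "k > 0" and xy: "x \<noteq> y" "x = z + v" "y = z' + v'"
    and G: "G x = jet k z v g" "G y = jet k z' v' g'"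
    and eq: "g' = g + v \<bullet> (z' - z)"
  shows "ennreal k \<le> Gamma1_pair G x y"
proof -
  let ?a = "v + z'"
  let ?N = "(norm (x - ?a))\<^sup>2 + (norm (y - ?a))\<^sup>2"
  have N: "?N > 0" using xy by (metis eq_iff_diff_eq_0 norm_eq_zero sum_power2_gt_zero_iff)
  have "k * ?N = 2 * (G x ?a - G y ?a)"
    using jet_difference[of k z v ?a z' v' g g'] G xy eq by simp
  then have "k = 2 * (G x ?a - G y ?a) / ?N"
    by (metis N less_irrefl nonzero_mult_div_cancel_right)
  then have "k = 2 * ((G x ?a - G y ?a) / ?N)" by simp
  also have "\<dots> \<le> 2 * (\<bar>G x ?a - G y ?a\<bar> / ?N)"
    using N by (intro mult_left_mono divide_right_mono) auto
  finally have "ennreal k \<le> ennreal (2 * (\<bar>G x ?a - G y ?a\<bar> / ?N))" by (rule ennreal_leI)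
  also have "\<dots> = 2 * ennreal (\<bar>G x ?a - G y ?a\<bar> / ?N)"
    using N by (subst ennreal_mult) auto
  also have "\<dots> \<le> Gamma1_pair G x y"
    unfolding Gamma1_pair_def by (intro mult_left_mono SUP_upper) auto
  finally show ?thesis .
qed


section \<open>The field of a convex envelope\<close>

text \<open>Well defined by \<open>subgrad_decomposition_exists\<close> and \<open>subgrad_decomposition_unique\<close>.\<close>

definition prox :: "('a::euclidean_space \<times> real) set \<Rightarrow> 'a \<Rightarrow> 'a" where
  "prox I x = (THE v. subgrad I (x - v) v)"

text \<open>The third coordinate is the conjugate of \<open>max_affine I\<close> at \<open>z = x - prox I x\<close>, that is, the
  value at \<open>z\<close> of the lower convex envelope of \<open>I\<close>; Fenchel's equality expresses it by \<open>z\<close> and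
  \<open>v = prox I x\<close>.\<close>

definition envelope_field ::
  "real \<Rightarrow> ('a::euclidean_space \<times> real) set \<Rightarrow> 'a \<Rightarrow> 'a \<Rightarrow> real" where
  "envelope_field k I x =
     jet k (x - prox I x) (prox I x) ((x - prox I x) \<bullet> prox I x - max_affine I (prox I x))"

lemma envelope_field_eq:
  assumes "subgrad I z v"
  shows "envelope_field k I (z + v) = jet k z v (z \<bullet> v - max_affine I v)"
proof -
  have "prox I (z + v) = v"
    unfolding prox_def
    by (rule the_equality) (use assms subgrad_decomposition_unique in force)+
  then show ?thesis unfolding envelope_field_def by simp
qed

text \<open>On the cell of a point \<open>(z, c)\<close> of \<open>I\<close> the envelope takes the value \<open>c\<close> itself.  This gives
  the interpolation of the data and, for the added point, the dependence on its height.\<close>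

lemma envelope_field_active:
  assumes "finite I" "i \<in> active I v"
  shows "envelope_field k I (fst i + v) = jet k (fst i) v (snd i)"
proof -
  have "fst i \<bullet> v - max_affine I v = snd i" using assms(2) by (auto simp: active_def)
  then show ?thesis using envelope_field_eq[OF subgrad_of_active[OF assms], of k] by simp
qed

text \<open>Two subgradients of \<open>max_affine I\<close> satisfy, after passing to the conjugate, exactly the two
  inequalities of \<open>Gamma1_pair_jets_le_iff\<close>.\<close>

lemma Gamma1_envelope_field_le:
  fixes I :: "((real^'n) \<times> real) set"
  assumes "finite I" "I \<noteq> {}" "k > 0"
  shows "Gamma1 (envelope_field k I) S \<le> ennreal k"
proof -
  have "Gamma1_pair (envelope_field k I) x y \<le> ennreal k" if xy: "x \<noteq> y" for x y
  proof -
    obtain v where v: "subgrad I (x - v) v" using subgrad_decomposition_exists assms by blast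
    obtain v' where v': "subgrad I (y - v') v'" using subgrad_decomposition_exists assms by blast
    define z where "z = x - v"
    define z' where "z' = y - v'"
    have sub: "subgrad I z v" "subgrad I z' v'" using v v' unfolding z_def z'_def by auto
    have x: "x = z + v" and y: "y = z' + v'" unfolding z_def z'_def by auto
    note G = envelope_field_eq[OF sub(1), of k, folded x] envelope_field_eq[OF sub(2), of k, folded y]
    have "max_affine I v + z \<bullet> (v' - v) \<le> max_affine I v'"
      and "max_affine I v' + z' \<bullet> (v - v') \<le> max_affine I v"
      using sub unfolding subgrad_def by auto
    then show ?thesis
      unfolding Gamma1_pair_jets_le_iff[OF assms(3) xy x y G]
      by (simp add: inner_diff_right inner_commute)
  qed
  then show ?thesis unfolding Gamma1_def by (intro SUP_least) auto
qed

lemma Gamma1_ge_pair: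
  assumes "x \<in> S" "y \<in> S" "x \<noteq> y"
  shows "Gamma1_pair G x y \<le> Gamma1 G S"
  unfolding Gamma1_def using assms by (intro SUP_upper2[of "(x, y)"]) auto

text \<open>The constant \<open>k\<close> is reached between points that share \<open>v\<close>, where the envelope is affine with
  slope \<open>v\<close>, and between points that share a \<open>z\<close> from \<open>I\<close>.\<close>

lemma Gamma1_envelope_field_ge_same_slope:
  fixes I :: "((real^'n) \<times> real) set"
  assumes "k > 0" "subgrad I z v" "subgrad I z' v" "z \<noteq> z'" "z + v \<in> S" "z' + v \<in> S"
  shows "ennreal k \<le> Gamma1 (envelope_field k I) S"
proof -
  have "ennreal k \<le> Gamma1_pair (envelope_field k I) (z + v) (z' + v)"
    by (rule Gamma1_pair_jets_ge[OF assms(1) _ refl refl envelope_field_eq[OF assms(2)]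
          envelope_field_eq[OF assms(3)]])
      (use assms in \<open>auto simp: inner_diff_right inner_commute\<close>)
  also have "\<dots> \<le> Gamma1 (envelope_field k I) S" using assms by (intro Gamma1_ge_pair) auto
  finally show ?thesis .
qed

lemma Gamma1_envelope_field_ge_same_piece:
  fixes I :: "((real^'n) \<times> real) set"
  assumes "k > 0" "finite I" "i \<in> active I v" "i \<in> active I v'" "v \<noteq> v'"
    "fst i + v \<in> S" "fst i + v' \<in> S"
  shows "ennreal k \<le> Gamma1 (envelope_field k I) S"
proof -
  have "ennreal k \<le> Gamma1_pair (envelope_field k I) (fst i + v) (fst i + v')"
    by (rule Gamma1_pair_jets_ge[OF assms(1) _ refl refl envelope_field_active[OF assms(2,3)]
          envelope_field_active[OF assms(2,4)]])
      (use assms in auto)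
  also have "\<dots> \<le> Gamma1 (envelope_field k I) S" using assms by (intro Gamma1_ge_pair) auto
  finally show ?thesis .
qed

section \<open>Absolute minimality\<close>

text \<open>In a subset that is minimal among those with the same maximum, an index that is nowhere
  strictly largest could be dropped.\<close>

lemma irredundant_subset:
  assumes fin: "finite I" "I \<noteq> {}"
  obtains J where "J \<subseteq> I" "J \<noteq> {}" "max_affine J = max_affine I"
    "\<And>i. i \<in> J \<Longrightarrow> \<exists>v. \<forall>j\<in>J - {i}. fst j \<bullet> v - snd j < fst i \<bullet> v - snd i"
proof -
  define \<J> where "\<J> = {J. J \<subseteq> I \<and> J \<noteq> {} \<and> max_affine J = max_affine I}"
  have "finite \<J>" "I \<in> \<J>" unfolding \<J>_def using fin by auto
  then obtain J where J: "J \<in> \<J>" "\<And>K. K \<in> \<J> \<Longrightarrow> K \<subseteq> J \<Longrightarrow> J = K"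
    by (metis empty_iff finite_has_minimal)
  have finJ: "finite J" "J \<noteq> {}" using J(1) fin unfolding \<J>_def by (auto intro: finite_subset)
  have "\<exists>v. \<forall>j\<in>J - {i}. fst j \<bullet> v - snd j < fst i \<bullet> v - snd i" if i: "i \<in> J" for i
  proof (rule ccontr)
    assume "\<not> ?thesis"
    then have dom: "\<exists>j\<in>J - {i}. fst i \<bullet> v - snd i \<le> fst j \<bullet> v - snd j" for v
      by (meson not_le)
    have "max_affine (J - {i}) v = max_affine J v" for v
    proof -
      obtain l where l: "l \<in> active J v" using max_affine_attained finJ by blast
      have "\<exists>j\<in>J - {i}. fst j \<bullet> v - snd j = max_affine J v"
      proof (cases "l = i")
        case True
        obtain j where j: "j \<in> J - {i}" "fst i \<bullet> v - snd i \<le> fst j \<bullet> v - snd j"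
          using dom by blast
        then show ?thesis using l True max_affine_ge[OF finJ(1), of j v]
          by (intro bexI[of _ j]) (auto simp: active_def)
      qed (use l in \<open>auto simp: active_def\<close>)
      then obtain j where j: "j \<in> J - {i}" "fst j \<bullet> v - snd j = max_affine J v" by blast
      have "Max ((\<lambda>i. fst i \<bullet> v - snd i) ` (J - {i})) = max_affine J v"
      proof (rule Max_eqI)
        show "max_affine J v \<in> (\<lambda>i. fst i \<bullet> v - snd i) ` (J - {i})"
          using j by (metis (no_types, lifting) image_eqI)
        show "y \<le> max_affine J v" if "y \<in> (\<lambda>i. fst i \<bullet> v - snd i) ` (J - {i})" for y
          using that max_affine_ge[OF finJ(1)] by auto
      qed (use finJ in auto)
      then show ?thesis unfolding max_affine_def[of "J - {i}"] .
    qed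
    moreover have "J - {i} \<noteq> {}" using dom by blast
    ultimately have "J - {i} \<in> \<J>" using J(1) unfolding \<J>_def by (auto simp: fun_eq_iff)
    then show False using J(2)[of "J - {i}"] i by blast
  qed
  then show ?thesis using that J(1) unfolding \<J>_def by blast
qed

lemma interior_active_nonempty:
  assumes "finite J" "i \<in> J" "\<forall>j\<in>J - {i}. fst j \<bullet> v - snd j < fst i \<bullet> v - snd i"
  shows "interior {w. i \<in> active J w} \<noteq> {}"
proof -
  define U where "U = (\<Inter>j\<in>J - {i}. {w. fst j \<bullet> w - snd j < fst i \<bullet> w - snd i})"
  have "open U"
    unfolding U_def using assms(1)
    by (intro open_INT ballI open_Collect_less continuous_intros) auto
  moreover have "U \<subseteq> {w. i \<in> active J w}"
  proof
    fix w assume w: "w \<in> U"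
    have "fst j \<bullet> w - snd j \<le> fst i \<bullet> w - snd i" if "j \<in> J" for j
    proof (cases "j = i")
      case False
      then have "w \<in> {w. fst j \<bullet> w - snd j < fst i \<bullet> w - snd i}"
        using w that unfolding U_def by blast
      then show ?thesis by simp
    qed simp
    then show "w \<in> {w. i \<in> active J w}" using active_iff[OF assms(1,2)] by simp
  qed
  moreover have "v \<in> U" using assms(3) unfolding U_def by auto
  ultimately show ?thesis using interior_maximal by blast
qed

lemma convex_active:
  assumes "finite I" "i \<in> I"
  shows "convex {w. i \<in> active I w}"
proof -
  have "{w. i \<in> active I w} = (\<Inter>j\<in>I. {w. (fst j - fst i) \<bullet> w \<le> snd j - snd i})"
    unfolding active_iff[OF assms] by (auto simp: inner_diff_left algebra_simps)
  then show ?thesis by (auto intro!: convex_INT convex_halfspace_le)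
qed

lemma second_point_in_convex_open:
  fixes T V :: "'a::real_normed_vector set"
  assumes "convex T" "open V" "x \<in> T" "x \<in> V" "T \<noteq> {x}"
  obtains y where "y \<in> T" "y \<in> V" "y \<noteq> x"
proof -
  obtain e where e: "e \<in> T" "e \<noteq> x" using assms by blast
  have "((\<lambda>t. x + t *\<^sub>R (e - x)) \<longlongrightarrow> x + 0 *\<^sub>R (e - x)) (at_right 0)"
    by (intro tendsto_intros)
  then have "\<forall>\<^sub>F t in at_right 0. x + t *\<^sub>R (e - x) \<in> V"
    by (rule topological_tendstoD) (use assms in auto)
  moreover have "\<forall>\<^sub>F t in at_right 0. t \<in> {0<..<1::real}"
    by (rule eventually_at_right_real) simp
  ultimately have "\<forall>\<^sub>F t in at_right 0. x + t *\<^sub>R (e - x) \<in> V \<and> t \<in> {0<..<1}"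
    by eventually_elim auto
  then obtain t where t: "x + t *\<^sub>R (e - x) \<in> V" "0 < t" "t < 1"
    by (metis (no_types, lifting) eventually_happens greaterThanLessThan_iff
        trivial_limit_at_right_real)
  have "x + t *\<^sub>R (e - x) = (1 - t) *\<^sub>R x + t *\<^sub>R e" by (simp add: algebra_simps)
  then have "x + t *\<^sub>R (e - x) \<in> T" using t e assms by (simp add: convex_alt)
  then show ?thesis using that t e by auto
qed

text \<open>The hypothesis \<open>leave\<close> says that no cell is swallowed by the closure of \<open>V\<close>; a cell contained in
  the open set \<open>V\<close> would have no point on the frontier.\<close>

lemma Gamma1_envelope_field_eq:
  fixes I :: "((real^'n) \<times> real) set" and V :: "(real^'n) set"
  assumes fin: "finite I" "I \<noteq> {}" and k: "k > 0" and dim: "CARD('n) \<ge> 2"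
    and V: "open V" "V \<noteq> {}"
    and leave: "\<And>i. i \<in> I \<Longrightarrow> \<exists>v. i \<in> active I v \<and> fst i + v \<notin> closure V"
  shows "Gamma1 (envelope_field k I) V = ennreal k"
    and "Gamma1 (envelope_field k I) (frontier V) = ennreal k"
proof -
  obtain J where J: "J \<subseteq> I" "J \<noteq> {}" and same: "max_affine J = max_affine I"
    and strict: "\<And>i. i \<in> J \<Longrightarrow> \<exists>v. \<forall>j\<in>J - {i}. fst j \<bullet> v - snd j < fst i \<bullet> v - snd i"
    using irredundant_subset[OF fin] by metis
  have finJ: "finite J" using J fin finite_subset by blast
  have act: "active J v \<subseteq> active I v" for v using J same unfolding active_def by auto
  have sub_iff: "subgrad I z v \<longleftrightarrow> z \<in> convex hull (fst ` active J v)" for z v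
    using subgrad_iff_hull[OF finJ J(2)] same unfolding subgrad_def by simp
  \<comment> \<open>A \<open>cell\<close> collects the base points with \<open>z = fst i\<close>, a \<open>face\<close> those with a given \<open>v\<close>.\<close>
  define cell where "cell i = (+) (fst i) ` {w. i \<in> active J w}" for i
  have cell: "convex (cell i)" "interior (cell i) \<noteq> {}" if i: "i \<in> J" for i
  proof -
    show "convex (cell i)"
      unfolding cell_def by (intro convex_translation convex_active finJ i)
    show "interior (cell i) \<noteq> {}"
      using strict[OF i] interior_active_nonempty[OF finJ i]
      unfolding cell_def interior_translation by blast
  qed
  have cell_ge: "ennreal k \<le> Gamma1 (envelope_field k I) S"
    if pq: "p \<in> cell i" "q \<in> cell i" "p \<noteq> q" "p \<in> S" "q \<in> S" for p q i S
  proof -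
    obtain w w' where w: "p = fst i + w" "i \<in> active I w" "q = fst i + w'" "i \<in> active I w'"
      using pq(1,2) act unfolding cell_def by blast
    then show ?thesis using pq
      by (intro Gamma1_envelope_field_ge_same_piece[OF k fin(1) w(2) w(4)]) auto
  qed
  define face where "face v = (+) v ` (convex hull (fst ` active J v))" for v
  have face_ge: "ennreal k \<le> Gamma1 (envelope_field k I) S"
    if pq: "p \<in> face v" "q \<in> face v" "p \<noteq> q" "p \<in> S" "q \<in> S" for p q v S
  proof -
    obtain z z' where z: "p = z + v" "subgrad I z v" "q = z' + v" "subgrad I z' v"
      using pq(1,2) unfolding face_def sub_iff by (auto simp: add.commute)
    then show ?thesis using pq
      by (intro Gamma1_envelope_field_ge_same_slope[OF k z(2) z(4)]) auto
  qed
  have face_hull: "face v = convex hull ((\<lambda>i. fst i + v) ` active J v)" for v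
    unfolding face_def convex_hull_translation[symmetric] image_image by (simp add: add.commute)
  have le: "Gamma1 (envelope_field k I) S \<le> ennreal k" for S
    by (rule Gamma1_envelope_field_le[OF fin k])
  obtain x where x: "x \<in> V" using V by blast
  obtain v where v: "subgrad I (x - v) v" using subgrad_decomposition_exists[OF fin] by blast
  then have xface: "x \<in> face v"
    unfolding face_def sub_iff by (auto intro!: image_eqI[of _ _ "x - v"])
  \<comment> \<open>Inside \<open>V\<close>, one of the face and the cell through \<open>x\<close> is not reduced to \<open>x\<close>, and it provides
    a second point near \<open>x\<close>.\<close>
  have "ennreal k \<le> Gamma1 (envelope_field k I) V"
  proof (cases "face v = {x}")
    case False
    have "convex (face v)" unfolding face_hull by (rule convex_convex_hull)
    from second_point_in_convex_open[OF this V(1) xface x False]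
    show ?thesis using face_ge xface x by metis
  next
    case True
    obtain i where i: "i \<in> active J v" using max_affine_attained[OF finJ J(2)] .
    then have iJ: "i \<in> J" unfolding active_def by simp
    have "fst i + v \<in> face v" unfolding face_hull using i by (intro hull_inc) auto
    then have "fst i + v = x" using True by simp
    then have xcell: "x \<in> cell i" unfolding cell_def using i by auto
    have "cell i \<noteq> {x}" using cell(2)[OF iJ] by auto
    from second_point_in_convex_open[OF cell(1)[OF iJ] V(1) xcell x this]
    show ?thesis using cell_ge xcell x by metis
  qed
  then show "Gamma1 (envelope_field k I) V = ennreal k" using le by (simp add: antisym)
  \<comment> \<open>On the frontier, the face through \<open>x\<close> is crossed twice unless one of its vertices is in \<open>V\<close>;
    then the cell of that vertex is crossed twice.\<close>
  have "ennreal k \<le> Gamma1 (envelope_field k I) (frontier V)"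
  proof (cases "(\<lambda>i. fst i + v) ` active J v \<inter> V = {}")
    case True
    from vertex_or_two_frontier_points_in_hull[OF V(1) x xface[unfolded face_hull] this]
    show ?thesis using face_ge unfolding face_hull by metis
  next
    case False
    then obtain i where i: "i \<in> active J v" "fst i + v \<in> V" by blast
    then have iJ: "i \<in> J" unfolding active_def by simp
    obtain w where w: "i \<in> active I w" "fst i + w \<notin> closure V" using leave iJ J by blast
    have "fst i + v \<in> cell i" "fst i + w \<in> cell i"
      using i w iJ same unfolding cell_def active_def by auto
    from two_frontier_points_in_convex[OF cell[OF iJ] _ V(1) this(1) i(2) this(2) w(2)]
    show ?thesis using cell_ge dim by (metis DIM_cart DIM_real mult.right_neutral)
  qed
  then show "Gamma1 (envelope_field k I) (frontier V) = ennreal k" using le by (simp add: antisym)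
qed

lemma Gamma1_cong:
  assumes "\<And>x. x \<in> S \<Longrightarrow> G x = F x"
  shows "Gamma1 G S = Gamma1 F S"
  unfolding Gamma1_def Gamma1_pair_def using assms by (intro SUP_cong) auto

lemma Gamma1_mono:
  assumes "S \<subseteq> T"
  shows "Gamma1 G S \<le> Gamma1 G T"
  unfolding Gamma1_def using assms by (intro SUP_subset_mono) auto

section \<open>Infinitely many absolutely minimal extensions\<close>

theorem corollary29:
  fixes A :: "(real^'n) set" and F :: "real^'n \<Rightarrow> real^'n \<Rightarrow> real"
  assumes "CARD('n) \<ge> 2"
    and "finite A" and "A \<noteq> {}"
    and "F \<in> F1 A"
    and "Gamma1 F A > 0"
  shows "infinite {G. AMLE A F UNIV G}"
proof -
  define k where "k = enn2real (Gamma1 F A)"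
  have fin: "Gamma1 F A < \<infinity>" and field: "one_field_on A F" using assms(4) unfolding F1_def by auto
  then have \<kappa>: "Gamma1 F A = ennreal k" unfolding k_def by simp
  have k: "k > 0" using assms(5) \<kappa> by (simp add: ennreal_zero_less_top flip: ennreal_less_zero_iff)
  have "\<forall>p\<in>A. \<exists>z v g. p = z + v \<and> F p = jet k z v g"
  proof
    fix p assume "p \<in> A"
    then obtain c D where F: "\<And>a. F p a = c + D \<bullet> (a - p)" using field unfolding one_field_on_def by blast
    have "k \<noteq> 0" using k by simp
    then obtain z v g where "p = z + v" "\<And>a. c + D \<bullet> (a - p) = jet k z v g a"
      using affine_as_jet by blast
    then show "\<exists>z v g. p = z + v \<and> F p = jet k z v g"
      using F by (intro exI[of _ z] exI[of _ v] exI[of _ g]) auto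
  qed
  then obtain z v g where zv: "\<And>p. p \<in> A \<Longrightarrow> p = z p + v p"
    and F: "\<And>p. p \<in> A \<Longrightarrow> F p = jet k (z p) (v p) (g p)"
    by metis
  have compat: "g p + v p \<bullet> (z q - z p) \<le> g q" if "p \<in> A" "q \<in> A" for p q
  proof (cases "p = q")
    case False
    have "Gamma1_pair F p q \<le> ennreal k" using Gamma1_ge_pair[OF that False, of F] \<kappa> by simp
    then show ?thesis
      using Gamma1_pair_jets_le_iff[OF k False zv[OF that(1)] zv[OF that(2)] F[OF that(1)] F[OF that(2)]]
      by simp
  qed simp
  obtain u :: "real^'n" where u: "norm u = 1" using vector_choose_size[of 1] by auto
  \<comment> \<open>The slope \<open>b\<close> is beyond all \<open>z p\<close> in direction \<open>u\<close>, hence outside their convex hull, and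
    its affine function dominates far out along \<open>u\<close>.\<close>
  define b where "b = (1 + (\<Sum>p\<in>A. norm (z p))) *\<^sub>R u"
  have ub: "u \<bullet> z p + 1 \<le> u \<bullet> b" if "p \<in> A" for p
  proof -
    have "u \<bullet> z p \<le> norm u * norm (z p)" by (rule norm_cauchy_schwarz)
    also have "\<dots> \<le> (\<Sum>p\<in>A. norm (z p))"
      using member_le_sum[of p A "\<lambda>p. norm (z p)"] that assms(2) u by simp
    finally show ?thesis unfolding b_def using u by (simp add: power2_norm_eq_inner[symmetric])
  qed
  \<comment> \<open>From this height on, the new point does not interfere with the data: \<open>v p\<close> is still a
    subgradient of the envelope at \<open>z p\<close>.\<close>
  define c0 where "c0 = (\<Sum>p\<in>A. \<bar>b \<bullet> v p - z p \<bullet> v p + g p\<bar>)"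
  define I where "I c = insert (b, c) ((\<lambda>p. (z p, g p)) ` A)" for c
  have finI: "finite (I c)" "I c \<noteq> {}" for c unfolding I_def using assms(2) by auto
  have act_data: "(z p, g p) \<in> active (I c) (v p)" if p: "p \<in> A" and c: "c \<ge> c0" for p c
  proof -
    have "\<bar>b \<bullet> v p - z p \<bullet> v p + g p\<bar> \<le> c0"
      unfolding c0_def by (rule member_le_sum) (use p assms(2) in auto)
    then have "b \<bullet> v p - c \<le> z p \<bullet> v p - g p" using c by linarith
    moreover have "z q \<bullet> v p - g q \<le> z p \<bullet> v p - g p" if "q \<in> A" for q
      using compat[OF p that] by (simp add: inner_diff_right inner_commute)
    ultimately show ?thesis
      by (subst active_iff[OF finI(1)]) (use p in \<open>auto simp: I_def\<close>)
  qed
  define T where "T c = (\<Sum>p\<in>A. \<bar>c - g p\<bar>)" for c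
  have act_far: "(b, c) \<in> active (I c) (t *\<^sub>R u)" if t: "t \<ge> T c" for c t
  proof -
    have "z p \<bullet> (t *\<^sub>R u) - g p \<le> b \<bullet> (t *\<^sub>R u) - c" if p: "p \<in> A" for p
    proof -
      have "\<bar>c - g p\<bar> \<le> T c"
        unfolding T_def by (rule member_le_sum) (use p assms(2) in auto)
      then have t': "c - g p \<le> t" "0 \<le> t" using t by linarith+
      have "t * (u \<bullet> z p + 1) \<le> t * (u \<bullet> b)" using ub[OF p] t' by (intro mult_left_mono) auto
      then show ?thesis using t' by (simp add: inner_commute algebra_simps)
    qed
    then show ?thesis by (subst active_iff[OF finI(1)]) (auto simp: I_def)
  qed
  define G where "G c = envelope_field k (I c)" for c
  have "AMLE A F UNIV (G c)" if c: "c \<ge> c0" for c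
  proof -
    have ext: "G c p = F p" if "p \<in> A" for p
      using envelope_field_active[OF finI(1) act_data[OF that c], of k] zv[OF that] F[OF that]
      unfolding G_def by simp
    have "Gamma1 (G c) UNIV \<le> ennreal k"
      unfolding G_def by (rule Gamma1_envelope_field_le[OF finI k])
    moreover have "ennreal k \<le> Gamma1 (G c) UNIV"
      using Gamma1_cong[of A "G c" F] ext \<kappa> Gamma1_mono[of A UNIV "G c"] by simp
    ultimately have \<kappa>G: "Gamma1 (G c) UNIV = Gamma1 F A" using \<kappa> by simp
    have "one_field_on UNIV (G c)"
      unfolding one_field_on_def G_def envelope_field_def
    proof
      fix x
      show "\<exists>c' D. \<forall>a. jet k (x - prox (I c) x) (prox (I c) x)
          ((x - prox (I c) x) \<bullet> prox (I c) x - max_affine (I c) (prox (I c) x)) a = c' + D \<bullet> (a - x)"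
        using jet_affine[of k "x - prox (I c) x" "prox (I c) x"]
        unfolding diff_add_cancel by blast
    qed
    then have "MLE A F UNIV (G c)"
      unfolding MLE_def F1_def using \<kappa>G fin ext by auto
    moreover have "Gamma1 (G c) V = Gamma1 (G c) (frontier V)"
      if V: "V \<noteq> {}" "bounded V" "open V" "closure V \<subseteq> UNIV - A" for V
    proof -
      have "\<exists>w. i \<in> active (I c) w \<and> fst i + w \<notin> closure V" if i: "i \<in> I c" for i
      proof (cases "i = (b, c)")
        case True
        \<comment> \<open>The cell of the added point contains a ray in direction \<open>u\<close>.\<close>
        obtain B where B: "\<And>x. x \<in> closure V \<Longrightarrow> norm x \<le> B"
          using bounded_closure[OF V(2)] unfolding bounded_iff by blast
        define t where "t = max (T c) (\<bar>B\<bar> + norm b + 1)"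
        have "t \<ge> \<bar>B\<bar> + norm b + 1" unfolding t_def by simp
        moreover from this have "norm (t *\<^sub>R u) = t" using u norm_ge_zero[of b] by (simp del: norm_ge_zero)
        moreover have "norm (t *\<^sub>R u) \<le> norm (b + t *\<^sub>R u) + norm b"
          using norm_triangle_ineq4[of "b + t *\<^sub>R u" b] by simp
        ultimately have "norm (b + t *\<^sub>R u) > B" by linarith
        then have "b + t *\<^sub>R u \<notin> closure V" using B by force
        moreover have "(b, c) \<in> active (I c) (t *\<^sub>R u)" by (rule act_far) (simp add: t_def)
        ultimately show ?thesis using True by auto
      next
        case False
        then obtain p where p: "p \<in> A" "i = (z p, g p)" using i unfolding I_def by auto
        then have "z p + v p \<notin> closure V" using V(4) zv[of p] by auto
        then show ?thesis using act_data[OF p(1) c] p by auto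
      qed
      from Gamma1_envelope_field_eq[OF finI k assms(1) V(3) V(1) this]
      show ?thesis unfolding G_def by simp
    qed
    ultimately show ?thesis unfolding AMLE_def by blast
  qed
  then have "G ` {c0..} \<subseteq> {G. AMLE A F UNIV G}" by auto
  moreover have "inj_on G {c0..}"
  proof (rule inj_onI)
    fix c c' assume eq: "G c = G c'"
    \<comment> \<open>A base point that lies in the cell of the added point for both heights, where the two
      fields have the third coordinate \<open>c\<close> and \<open>c'\<close>.\<close>
    define t where "t = max (T c) (T c')"
    have "G c (b + t *\<^sub>R u) = jet k b (t *\<^sub>R u) c" "G c' (b + t *\<^sub>R u) = jet k b (t *\<^sub>R u) c'"
      using envelope_field_active[OF finI(1) act_far, of c t k]
        envelope_field_active[OF finI(1) act_far, of c' t k]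
      unfolding G_def t_def by auto
    then have "jet k b (t *\<^sub>R u) c 0 = jet k b (t *\<^sub>R u) c' 0" using eq by simp
    then show "c = c'" using k unfolding jet_def by simp
  qed
  then have "infinite (G ` {c0..})" by (simp add: finite_image_iff infinite_Ici)
  ultimately show ?thesis by (rule infinite_super)
qed

end
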